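(* Let $2\le N\le M$ and let $\hat\mu_{n,i}>0$ for $n\in\{1,\dots,N\}$, $i\in\{1,\dots,M\}$. Define $u_n(\boldsymbol a)=\hat\mu_{n,a_n}\eta_{a_n}(\boldsymbol a)$, $u_{n,\max}=\max_{\boldsymbol a}u_n(\boldsymbol a)$, assume $\sum_n u_n(\boldsymbol a)$ has a unique maximizer $\boldsymbol a^*$ with value $J_1$, and let $z^*$ be the state in which every player has baseline $\bar a_n=a^*_n$ and is content. Let $c>0$ satisfy $c>\sum_{n=1}^N u_{n,\max}-J_1$, and for $0<\varepsilon<1$ consider the Game of Thrones Markov chain $P^\varepsilon$ described in the context. Then for every $0<\eta<\frac12$ there exists $\varepsilon_0>0$ such that for every $0<\varepsilon<\varepsilon_0$, every stationary distribution $\pi$ of $P^\varepsilon$ satisfies $\pi(z^* )>\frac{1}{2(1-\eta)}$.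
   Context: For a strategy profile $\boldsymbol a\in\{1,\dots,M\}^N$ and arm $i$, $\eta_i(\boldsymbol a)=0$ if more than one player chose arm $i$, and $1$ otherwise. Game of Thrones (GoT) dynamics with parameters $\varepsilon\in(0,1)$ and $c>0$: the state is $z=(\bar a_n,S_n)_{n=1}^N$ where $\bar a_n\in\{1,\dots,M\}$ is player $n$'s baseline action and $S_n\in\{C,D\}$ (content/discontent), so the state space is $\prod_{n=1}^N(\{1,\dots,M\}\times\{C,D\})$. In each step, players independently choose actions: a content player plays $a_n=\bar a_n$ with probability $1-\varepsilon^c$ and each other arm with probability $\frac{\varepsilon^c}{M-1}$; a discontent player plays each arm with probability $\frac1M$. Then, with $u_n=u_n(\boldsymbol a)$ for the played profile $\boldsymbol a$, each player independently updates: if $S_n=C$, $a_n=\bar a_n$ and $u_n>0$, the new state is $[\bar a_n,C]$; otherwise (i.e., $a_n\ne\bar a_n$ or $u_n=0$ or $S_n=D$) the new state is $[a_n,C]$ with probability $\frac{u_n}{u_{n,\max}}\varepsilon^{u_{n,\max}-u_n}$ and $[a_n,D]$ with the remaining probability. $P^\varepsilon$ denotes the resulting transition matrix. *)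

theory Defs
  imports Complex_Main "HOL-Library.FuncSet"
begin

text \<open>Players are 1..N, arms are 1..M. A strategy profile is an extensional
function in PiE {1..N} (\<lambda>_. {1..M}). A state assigns to each player a pair
(baseline arm, content flag) where True = content (C), False = discontent (D).\<close>

definition profiles :: "nat \<Rightarrow> nat \<Rightarrow> (nat \<Rightarrow> nat) set" where
  "profiles N M = PiE {1..N} (\<lambda>_. {1..M})"

definition states :: "nat \<Rightarrow> nat \<Rightarrow> (nat \<Rightarrow> nat \<times> bool) set" where
  "states N M = PiE {1..N} (\<lambda>_. {1..M} \<times> (UNIV :: bool set))"

definition eta :: "nat \<Rightarrow> nat \<Rightarrow> (nat \<Rightarrow> nat) \<Rightarrow> real" where
  "eta N i a = (if card {n \<in> {1..N}. a n = i} > 1 then 0 else 1)"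

definition util :: "nat \<Rightarrow> (nat \<Rightarrow> nat \<Rightarrow> real) \<Rightarrow> nat \<Rightarrow> (nat \<Rightarrow> nat) \<Rightarrow> real" where
  "util N mu n a = mu n (a n) * eta N (a n) a"

definition umax :: "nat \<Rightarrow> nat \<Rightarrow> (nat \<Rightarrow> nat \<Rightarrow> real) \<Rightarrow> nat \<Rightarrow> real" where
  "umax N M mu n = Max ((\<lambda>a. util N mu n a) ` profiles N M)"

definition act_prob :: "nat \<Rightarrow> real \<Rightarrow> real \<Rightarrow> nat \<times> bool \<Rightarrow> nat \<Rightarrow> real" where
  "act_prob M c \<epsilon> s b =
     (if snd s then (if b = fst s then 1 - \<epsilon> powr c else \<epsilon> powr c / (real M - 1))
      else 1 / real M)"

definition upd_prob :: "nat \<Rightarrow> nat \<Rightarrow> (nat \<Rightarrow> nat \<Rightarrow> real) \<Rightarrow> real \<Rightarrow> nat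
     \<Rightarrow> nat \<times> bool \<Rightarrow> (nat \<Rightarrow> nat) \<Rightarrow> nat \<times> bool \<Rightarrow> real" where
  "upd_prob N M mu \<epsilon> n s a s' =
     (let u = util N mu n a; um = umax N M mu n in
      if snd s \<and> a n = fst s \<and> u > 0 then (if s' = (fst s, True) then 1 else 0)
      else (let p = u / um * \<epsilon> powr (um - u) in
            if s' = (a n, True) then p else if s' = (a n, False) then 1 - p else 0))"

definition GoT_P :: "nat \<Rightarrow> nat \<Rightarrow> (nat \<Rightarrow> nat \<Rightarrow> real) \<Rightarrow> real \<Rightarrow> real
     \<Rightarrow> (nat \<Rightarrow> nat \<times> bool) \<Rightarrow> (nat \<Rightarrow> nat \<times> bool) \<Rightarrow> real" where
  "GoT_P N M mu c \<epsilon> z z' =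
     (\<Sum>a\<in>profiles N M.
        (\<Prod>n\<in>{1..N}. act_prob M c \<epsilon> (z n) (a n)) *
        (\<Prod>n\<in>{1..N}. upd_prob N M mu \<epsilon> n (z n) a (z' n)))"

definition stationary :: "nat \<Rightarrow> nat \<Rightarrow> (nat \<Rightarrow> nat \<Rightarrow> real) \<Rightarrow> real \<Rightarrow> real
     \<Rightarrow> ((nat \<Rightarrow> nat \<times> bool) \<Rightarrow> real) \<Rightarrow> bool" where
  "stationary N M mu c \<epsilon> \<pi> \<longleftrightarrow>
     (\<forall>z\<in>states N M. \<pi> z \<ge> 0) \<and>
     (\<Sum>z\<in>states N M. \<pi> z) = 1 \<and>
     (\<forall>z'\<in>states N M. (\<Sum>z\<in>states N M. \<pi> z * GoT_P N M mu c \<epsilon> z z') = \<pi> z')"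

end

theory Submission
  imports Defs
begin

text \<open>
  Let \<open>\<rho>(z)\<close> be the sum of \<open>u\<^sub>m\<^sub>a\<^sub>x - \<mu>\<close> over the content players of z, each at its baseline, and
  call z settled if all players are content on distinct arms. Up to constants, every stationary
  measure is bounded by \<open>\<pi>(d)\<close> times the weight \<open>w(z) = \<epsilon>\<close> to the power \<open>\<rho>(z)\<close>, or \<open>\<rho>(z) - c\<close> if z is
  settled, where d is a state with all players discontent. Indeed, the flow \<open>w(y) P(y,x)\<close> into x
  never exceeds the order \<open>\<epsilon>\<^sup>\<rho>\<^sup>(\<^sup>x\<^sup>)\<close>, whereas from every \<open>x \<noteq> d\<close> a flow of exactly this order leads, by
  collisions that make players discontent, towards d without increasing \<open>\<rho>\<close>. Comparing inflow and
  outflow across cuts bounds \<open>\<pi>/w\<close> successively on larger sets containing d.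

  The balance equation at \<open>z\<^sup>*\<close> gives the reverse bound: \<open>\<pi>(z\<^sup>*)\<close> is at least of order \<open>\<pi>(d) w(z\<^sup>*)\<close>. Since
  \<open>c > \<rho>(z\<^sup>*)\<close> and \<open>z\<^sup>*\<close> is the unique settled state of least \<open>\<rho>\<close>, every other weight is of lower order
  than \<open>w(z\<^sup>*)\<close>, so \<open>\<pi>(z\<^sup>*) \<rightarrow> 1\<close>.
\<close>

section \<open>Comparing a stationary measure with a weight function\<close>

locale stationary_chain =
  fixes S :: "'s set" and P :: "'s \<Rightarrow> 's \<Rightarrow> real" and \<pi> :: "'s \<Rightarrow> real"
  assumes fin: "finite S"
    and P_nonneg: "\<And>x y. x \<in> S \<Longrightarrow> y \<in> S \<Longrightarrow> 0 \<le> P x y"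
    and row_sum: "\<And>x. x \<in> S \<Longrightarrow> (\<Sum>y\<in>S. P x y) = 1"
    and pi_nonneg: "\<And>x. x \<in> S \<Longrightarrow> 0 \<le> \<pi> x"
    and balance: "\<And>y. y \<in> S \<Longrightarrow> (\<Sum>x\<in>S. \<pi> x * P x y) = \<pi> y"
begin

text \<open>The mass of \<open>T\<close> is written once through the row sums and once through the
  balance equations; the flow inside \<open>T\<close> occurs in both and cancels.\<close>

lemma cut_balance:
  assumes "T \<subseteq> S"
  shows "(\<Sum>x\<in>T. \<Sum>y\<in>S - T. \<pi> x * P x y) = (\<Sum>y\<in>S - T. \<Sum>x\<in>T. \<pi> y * P y x)"
proof -
  have split: "(\<Sum>y\<in>S. f y) = (\<Sum>y\<in>T. f y) + (\<Sum>y\<in>S - T. f y)" for f :: "'s \<Rightarrow> real"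
    using sum.subset_diff[OF assms fin, of f] by simp
  have "(\<Sum>x\<in>T. \<pi> x) = (\<Sum>x\<in>T. \<Sum>y\<in>S. \<pi> x * P x y)"
    using assms row_sum by (intro sum.cong) (auto simp: sum_distrib_left[symmetric])
  also have "\<dots> = (\<Sum>x\<in>T. \<Sum>y\<in>T. \<pi> x * P x y) + (\<Sum>x\<in>T. \<Sum>y\<in>S - T. \<pi> x * P x y)"
    by (simp add: split sum.distrib)
  finally have 1: "(\<Sum>x\<in>T. \<pi> x) = \<dots>" .
  have "(\<Sum>x\<in>T. \<pi> x) = (\<Sum>x\<in>T. \<Sum>y\<in>S. \<pi> y * P y x)"
    using assms balance by (intro sum.cong) auto
  also have "\<dots> = (\<Sum>x\<in>T. \<Sum>y\<in>T. \<pi> y * P y x) + (\<Sum>x\<in>T. \<Sum>y\<in>S - T. \<pi> y * P y x)"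
    by (simp add: split sum.distrib)
  finally have 2: "(\<Sum>x\<in>T. \<pi> x) = \<dots>" .
  have "(\<Sum>x\<in>T. \<Sum>y\<in>T. \<pi> y * P y x) = (\<Sum>x\<in>T. \<Sum>y\<in>T. \<pi> x * P x y)"
    by (rule sum.swap)
  moreover have "(\<Sum>x\<in>T. \<Sum>y\<in>S - T. \<pi> y * P y x) = (\<Sum>y\<in>S - T. \<Sum>x\<in>T. \<pi> y * P y x)"
    by (rule sum.swap)
  ultimately show ?thesis using 1 2 by simp
qed

text \<open>Every edge into \<open>x\<close> carries a weighted flow of order at most
  \<open>\<phi> x\<close>, while one escape edge carries that order out. Escape edges never lower
  \<open>\<phi>\<close> and strictly lower \<open>m\<close>, so a suitable state of \<open>T\<close>
  has its escape edge across the cut. Equality of the two flows across the cut then compares the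
  ratios.\<close>

lemma cut_comparison:
  fixes w \<phi> :: "'s \<Rightarrow> real" and m :: "'s \<Rightarrow> nat" and C k :: real
  assumes w: "\<And>x. x \<in> S \<Longrightarrow> 0 < w x" and phi: "\<And>x. x \<in> S \<Longrightarrow> 0 < \<phi> x"
    and inflow: "\<And>x y. x \<in> S \<Longrightarrow> y \<in> S \<Longrightarrow> x \<noteq> y \<Longrightarrow> w y * P y x \<le> C * \<phi> x"
    and escape: "\<And>x. x \<in> S \<Longrightarrow> x \<noteq> d \<Longrightarrow>
      \<exists>y\<in>S. k * \<phi> x \<le> w x * P x y \<and> \<phi> x \<le> \<phi> y \<and> m y < m x"
    and C: "0 \<le> C" and T: "T \<subseteq> S" "T \<noteq> {}" "d \<in> S - T"
  shows "\<exists>x\<in>T. \<exists>y\<in>S - T. k * (\<pi> x / w x) \<le> C * (real (card S))\<^sup>2 * (\<pi> y / w y)"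
proof -
  have finT: "finite T" using T fin finite_subset by blast
  have "Max (\<phi> ` T) \<in> \<phi> ` T" using finT T(2) by (intro Max_in) auto
  then obtain t where t: "t \<in> T" "\<And>x. x \<in> T \<Longrightarrow> \<phi> x \<le> \<phi> t"
    using Max_ge[OF finite_imageI[OF finT], of _ \<phi>] by (auto elim!: imageE)
  \<comment> \<open>Minimising \<open>m\<close> among the maximisers of \<open>\<phi>\<close> forces the escape edge of x0 to leave T.\<close>
  obtain x0 where x0: "x0 \<in> T" "\<phi> x0 = \<phi> t"
      "\<And>x. x \<in> T \<Longrightarrow> \<phi> x = \<phi> t \<Longrightarrow> m x0 \<le> m x"
    using ex_has_least_nat[of "\<lambda>x. x \<in> T \<and> \<phi> x = \<phi> t" t m] t(1) by auto
  have x0S: "x0 \<in> S" "x0 \<noteq> d" using x0 T by auto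
  obtain y0 where y0: "y0 \<in> S" "k * \<phi> x0 \<le> w x0 * P x0 y0" "\<phi> x0 \<le> \<phi> y0" "m y0 < m x0"
    using escape[OF x0S] by blast
  have "y0 \<notin> T"
  proof
    assume "y0 \<in> T"
    then have "\<phi> y0 = \<phi> t" using t(2) y0(3) x0(2) by fastforce
    then show False using x0(3)[OF \<open>y0 \<in> T\<close>] y0(4) by simp
  qed
  then have y0T: "y0 \<in> S - T" using y0(1) by simp
  have ne: "S - T \<noteq> {}" using T by auto
  define q where "q = (\<lambda>x. \<pi> x / w x)"
  have "Max (q ` (S - T)) \<in> q ` (S - T)" using fin ne by (intro Max_in) auto
  then obtain y1 where y1: "y1 \<in> S - T" "\<And>y. y \<in> S - T \<Longrightarrow> q y \<le> q y1"
    using Max_ge[OF finite_imageI[OF finite_Diff[OF fin]], of _ q T] by (auto elim!: imageE)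
  have q0: "0 \<le> q x" if "x \<in> S" for x
    using that w[of x] pi_nonneg[of x] by (simp add: q_def)
  have piq: "\<pi> x = q x * w x" if "x \<in> S" for x using w[OF that] by (simp add: q_def)
  have "q x0 * (k * \<phi> x0) \<le> q x0 * (w x0 * P x0 y0)"
    using y0(2) q0[OF x0S(1)] by (rule mult_left_mono)
  also have "\<dots> = \<pi> x0 * P x0 y0" using piq[OF x0S(1)] by simp
  also have "\<dots> \<le> (\<Sum>y\<in>S - T. \<pi> x0 * P x0 y)"
    using y0T x0S fin P_nonneg pi_nonneg
    by (intro member_le_sum) auto
  also have "\<dots> \<le> (\<Sum>x\<in>T. \<Sum>y\<in>S - T. \<pi> x * P x y)"
    using x0 T finT P_nonneg pi_nonneg
    by (intro member_le_sum[where f = "\<lambda>x. \<Sum>y\<in>S - T. \<pi> x * P x y"] sum_nonneg) auto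
  also have "\<dots> = (\<Sum>y\<in>S - T. \<Sum>x\<in>T. \<pi> y * P y x)"
    using T by (intro cut_balance)
  \<comment> \<open>The choice of \<open>y1\<close> bounds the ratio and the maximality of
    \<open>\<phi> x0\<close> on \<open>T\<close> bounds the inflow, so all edges share one
    bound.\<close>
  also have "\<dots> \<le> (\<Sum>y\<in>S - T. \<Sum>x\<in>T. q y1 * (C * \<phi> x0))"
  proof (intro sum_mono)
    fix y x assume yx: "y \<in> S - T" "x \<in> T"
    have "\<pi> y * P y x = q y * (w y * P y x)" using piq yx by simp
    also have "\<dots> \<le> q y1 * (C * \<phi> x0)"
    proof (rule mult_mono)
      have "w y * P y x \<le> C * \<phi> x" using yx T by (intro inflow) auto
      also have "\<dots> \<le> C * \<phi> x0" using t(2)[OF yx(2)] x0(2) C by (intro mult_left_mono) auto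
      finally show "w y * P y x \<le> C * \<phi> x0" .
    qed (use yx y1 q0 T w[of y] P_nonneg[of y x] in auto)
    finally show "\<pi> y * P y x \<le> q y1 * (C * \<phi> x0)" .
  qed
  also have "\<dots> = real (card (S - T)) * real (card T) * (q y1 * (C * \<phi> x0))" by simp
  also have "\<dots> \<le> real (card S) * real (card S) * (q y1 * (C * \<phi> x0))"
    using card_mono[OF fin T(1)] card_mono[OF fin, of "S - T"] q0[of y1] y1 C phi[OF x0S(1)]
    by (intro mult_right_mono mult_mono) auto
  \<comment> \<open>Cancelling \<open>\<phi> x0\<close> leaves a constant built from
    \<open>C\<close>, \<open>k\<close> and the number of states only.\<close>
  finally have "\<phi> x0 * (k * q x0) \<le> \<phi> x0 * (C * (real (card S))\<^sup>2 * q y1)"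
    by (simp add: power2_eq_square mult_ac)
  then have "k * q x0 \<le> C * (real (card S))\<^sup>2 * q y1"
    using phi[OF x0S(1)] by simp
  then show ?thesis using x0(1) y1(1) by (auto simp: q_def)
qed

text \<open>Starting from \<open>{d}\<close>, the cut comparison applied to the complement of the
  set reached so far adds one state and costs a factor \<open>K\<close>. After at most
  \<open>card S\<close> rounds all of \<open>S\<close> is reached.\<close>

lemma weight_comparison:
  fixes w \<phi> :: "'s \<Rightarrow> real" and m :: "'s \<Rightarrow> nat" and C k :: real
  assumes w: "\<And>x. x \<in> S \<Longrightarrow> 0 < w x" and phi: "\<And>x. x \<in> S \<Longrightarrow> 0 < \<phi> x"
    and inflow: "\<And>x y. x \<in> S \<Longrightarrow> y \<in> S \<Longrightarrow> x \<noteq> y \<Longrightarrow> w y * P y x \<le> C * \<phi> x"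
    and escape: "\<And>x. x \<in> S \<Longrightarrow> x \<noteq> d \<Longrightarrow>
      \<exists>y\<in>S. k * \<phi> x \<le> w x * P x y \<and> \<phi> x \<le> \<phi> y \<and> m y < m x"
    and C: "0 \<le> C" and k: "0 < k" and d: "d \<in> S" and x: "x \<in> S"
  shows "\<pi> x / w x \<le> max 1 (C * (real (card S))\<^sup>2 / k) ^ card S * (\<pi> d / w d)"
proof -
  define K where "K = max 1 (C * (real (card S))\<^sup>2 / k)"
  have K1: "1 \<le> K" by (simp add: K_def)
  have qd: "0 \<le> \<pi> d / w d" using w[OF d] pi_nonneg[OF d] by simp
  \<comment> \<open>The size is capped by \<open>card S\<close> because \<open>R\<close> may exhaust
    \<open>S\<close> early; \<open>j = card S\<close> then forces \<open>R = S\<close>.\<close>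
  have "\<exists>R\<subseteq>S. d \<in> R \<and> min (card S) (Suc j) \<le> card R \<and>
      (\<forall>x\<in>R. \<pi> x / w x \<le> K ^ j * (\<pi> d / w d))" for j
  proof (induction j)
    case 0
    show ?case using d by (intro exI[of _ "{d}"]) auto
  next
    case (Suc j)
    then obtain R where R: "R \<subseteq> S" "d \<in> R" "min (card S) (Suc j) \<le> card R"
      "\<And>x. x \<in> R \<Longrightarrow> \<pi> x / w x \<le> K ^ j * (\<pi> d / w d)" by blast
    have mono: "K ^ j * (\<pi> d / w d) \<le> K ^ Suc j * (\<pi> d / w d)"
      using K1 qd by (intro mult_right_mono power_increasing) auto
    show ?case
    proof (cases "R = S")
      case True
      then show ?thesis using R d mono by (intro exI[of _ S]) (auto intro: order_trans)
    next
      case False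
      have SR: "S - (S - R) = R" using R by auto
      obtain x y where xy: "x \<in> S - R" "y \<in> R"
        "k * (\<pi> x / w x) \<le> C * (real (card S))\<^sup>2 * (\<pi> y / w y)"
        using cut_comparison[where T = "S - R", OF w phi inflow escape C] R(1,2) False d
        unfolding SR by blast
      have qy: "0 \<le> \<pi> y / w y" using w[of y] pi_nonneg[of y] R xy by auto
      have "\<pi> x / w x \<le> (C * (real (card S))\<^sup>2 / k) * (\<pi> y / w y)"
        using xy(3) k by (metis mult.commute pos_le_divide_eq times_divide_eq_left)
      also have "\<dots> \<le> K * (\<pi> y / w y)" using qy by (intro mult_right_mono) (auto simp: K_def)
      also have "\<dots> \<le> K * (K ^ j * (\<pi> d / w d))"
        using R(4)[OF xy(2)] K1 by (intro mult_left_mono) auto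
      finally have "\<pi> x / w x \<le> K ^ Suc j * (\<pi> d / w d)" by (simp add: mult.assoc)
      moreover have "card (insert x R) = Suc (card R)"
        using xy R fin finite_subset by (metis DiffD2 card_insert_disjoint)
      ultimately show ?thesis using R xy mono
        by (intro exI[of _ "insert x R"]) (auto intro: order_trans)
    qed
  qed
  from this[of "card S"] obtain R where R: "R \<subseteq> S" "card S \<le> card R"
    "\<And>x. x \<in> R \<Longrightarrow> \<pi> x / w x \<le> K ^ card S * (\<pi> d / w d)" by auto
  have "R = S" using R fin by (simp add: card_seteq)
  then show ?thesis using R x by (simp add: K_def)
qed

end

section \<open>Utilities and one-step probabilities\<close>

locale got =
  fixes N M :: nat and mu :: "nat \<Rightarrow> nat \<Rightarrow> real" and c :: real
  assumes N2: "2 \<le> N" and NM: "N \<le> M"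
    and mu_pos: "\<And>n i. n \<in> {1..N} \<Longrightarrow> i \<in> {1..M} \<Longrightarrow> 0 < mu n i"
    and c_pos: "0 < c"
begin

lemma M2: "2 \<le> M" using N2 NM by simp

lemma finite_profiles: "finite (profiles N M)"
  by (auto simp: profiles_def intro: finite_PiE)

lemma finite_states: "finite (states N M)"
  by (auto simp: states_def intro!: finite_PiE)

lemma card_profiles: "card (profiles N M) = M ^ N"
  by (simp add: profiles_def card_PiE)

lemma profile_arm: "a \<in> profiles N M \<Longrightarrow> n \<in> {1..N} \<Longrightarrow> a n \<in> {1..M}"
  by (auto simp: profiles_def)

lemma state_arm: "z \<in> states N M \<Longrightarrow> n \<in> {1..N} \<Longrightarrow> fst (z n) \<in> {1..M}"
  by (auto simp: states_def PiE_def Pi_def mem_Times_iff)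

lemma restrict_in_profiles:
  "(\<And>n. n \<in> {1..N} \<Longrightarrow> f n \<in> {1..M}) \<Longrightarrow> restrict f {1..N} \<in> profiles N M"
  unfolding profiles_def by (rule restrict_PiE_iff[THEN iffD2]) auto

lemma restrict_in_states:
  "(\<And>n. n \<in> {1..N} \<Longrightarrow> fst (f n) \<in> {1..M}) \<Longrightarrow> restrict f {1..N} \<in> states N M"
  unfolding states_def by (rule restrict_PiE_iff[THEN iffD2]) (auto simp: mem_Times_iff)

lemma states_eqI:
  "x \<in> states N M \<Longrightarrow> y \<in> states N M \<Longrightarrow> (\<And>n. n \<in> {1..N} \<Longrightarrow> x n = y n) \<Longrightarrow> x = y"
  unfolding states_def by (rule PiE_ext) auto

text \<open>Player \<open>n\<close> is itself counted on its arm, so the count in \<open>eta\<close>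
  exceeds 1 exactly when someone else is there too.\<close>

lemma util_eq:
  assumes "n \<in> {1..N}"
  shows "util N mu n a = (if \<exists>m\<in>{1..N}. m \<noteq> n \<and> a m = a n then 0 else mu n (a n))"
proof -
  let ?A = "{m \<in> {1..N}. a m = a n}"
  have "card ?A > 1 \<longleftrightarrow> \<not> ?A \<subseteq> {n}"
  proof
    assume "card ?A > 1"
    then show "\<not> ?A \<subseteq> {n}" using card_mono[of "{n}" ?A] by auto
  next
    assume "\<not> ?A \<subseteq> {n}"
    then have "{n} \<subset> ?A" using assms by auto
    then show "card ?A > 1" using psubset_card_mono[of ?A "{n}"] by simp
  qed
  then show ?thesis by (auto simp: util_def eta_def)
qed

lemma util_collide:
  "n \<in> {1..N} \<Longrightarrow> m \<in> {1..N} \<Longrightarrow> m \<noteq> n \<Longrightarrow> a m = a n \<Longrightarrow> util N mu n a = 0"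
  using util_eq by auto

lemma util_nonneg:
  assumes "a \<in> profiles N M" "n \<in> {1..N}"
  shows "0 \<le> util N mu n a"
  using mu_pos[OF assms(2) profile_arm[OF assms]] by (simp add: util_eq[OF assms(2)])

lemma util_pos_eq:
  assumes "n \<in> {1..N}" "util N mu n a > 0"
  shows "util N mu n a = mu n (a n)"
  using assms by (auto simp: util_eq split: if_splits)

lemma util_le_umax:
  assumes "a \<in> profiles N M"
  shows "util N mu n a \<le> umax N M mu n"
  unfolding umax_def using assms finite_profiles by (intro Max_ge) auto

lemma mu_le_umax:
  assumes "n \<in> {1..N}" "i \<in> {1..M}"
  shows "mu n i \<le> umax N M mu n"
proof -
  \<comment> \<open>All other players are sent to an arm \<open>j\<close> different from
    \<open>i\<close>, which leaves \<open>n\<close> alone on \<open>i\<close>.\<close>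
  obtain j where j: "j \<in> {1..M}" "j \<noteq> i"
    using M2 assms(2) by (cases "i = 1") (auto intro: that[of 1] that[of 2])
  let ?a = "restrict (\<lambda>m. if m = n then i else j) {1..N}"
  have "?a \<in> profiles N M" using assms j by (intro restrict_in_profiles) auto
  moreover have "util N mu n ?a = mu n i" using assms j by (auto simp: util_eq)
  ultimately show ?thesis using util_le_umax by metis
qed

lemma umax_pos: "n \<in> {1..N} \<Longrightarrow> 0 < umax N M mu n"
  using mu_le_umax[of n 1] mu_pos[of n 1] M2 by force

text \<open>The exponent of \<open>\<epsilon>\<close> that a player pays for becoming content at its current baseline.\<close>

definition cost :: "nat \<Rightarrow> nat \<times> bool \<Rightarrow> real" where
  "cost n s = (if snd s then umax N M mu n - mu n (fst s) else 0)"

definition total_cost :: "(nat \<Rightarrow> nat \<times> bool) \<Rightarrow> real" where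
  "total_cost z = (\<Sum>n\<in>{1..N}. cost n (z n))"

text \<open>The states that are absorbing in the limit \<open>\<epsilon> = 0\<close>.\<close>

definition settled :: "(nat \<Rightarrow> nat \<times> bool) \<Rightarrow> bool" where
  "settled z \<longleftrightarrow> (\<forall>n\<in>{1..N}. snd (z n)) \<and> inj_on (\<lambda>n. fst (z n)) {1..N}"

lemma cost_nonneg:
  assumes "z \<in> states N M" "n \<in> {1..N}"
  shows "0 \<le> cost n (z n)"
  using mu_le_umax[OF assms(2) state_arm[OF assms]] by (simp add: cost_def)

lemma total_cost_nonneg: "z \<in> states N M \<Longrightarrow> 0 \<le> total_cost z"
  unfolding total_cost_def by (intro sum_nonneg cost_nonneg)

end

section \<open>Bounds on action and update probabilities, and stochasticity of the chain\<close>

locale got_eps = got +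
  fixes \<epsilon> :: real
  assumes eps_pos: "0 < \<epsilon>" and eps_lt1: "\<epsilon> < 1"
begin

lemma powr_le1: "0 \<le> t \<Longrightarrow> \<epsilon> powr t \<le> 1"
  using eps_pos eps_lt1 by (intro powr_le1) auto

lemma act_prob_bounds:
  "0 \<le> act_prob M c \<epsilon> s b" "act_prob M c \<epsilon> s b \<le> 1"
proof -
  have "\<epsilon> powr c \<le> 1" using powr_le1 c_pos by simp
  moreover have "\<epsilon> powr c / (real M - 1) \<le> \<epsilon> powr c"
    using M2 by (intro divide_le_eq[THEN iffD2]) (auto simp: mult_le_cancel_left1)
  ultimately show "0 \<le> act_prob M c \<epsilon> s b" "act_prob M c \<epsilon> s b \<le> 1"
    using M2 by (auto simp: act_prob_def)
qed

lemma act_prob_deviate_le: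
  "snd s \<Longrightarrow> b \<noteq> fst s \<Longrightarrow> act_prob M c \<epsilon> s b \<le> \<epsilon> powr c"
  using M2 by (auto simp: act_prob_def divide_le_eq mult_le_cancel_left1)

lemma content_prob_bounds:
  assumes "a \<in> profiles N M" "n \<in> {1..N}"
  defines "p \<equiv> util N mu n a / umax N M mu n * \<epsilon> powr (umax N M mu n - util N mu n a)"
  shows "0 \<le> p" "p \<le> 1" "p \<le> \<epsilon> powr (umax N M mu n - util N mu n a)"
proof -
  have le: "util N mu n a / umax N M mu n \<le> 1" and ge: "0 \<le> util N mu n a / umax N M mu n"
    using util_le_umax[OF assms(1)] util_nonneg[OF assms(1,2)] umax_pos[OF assms(2)] by auto
  show "0 \<le> p" unfolding p_def by (intro mult_nonneg_nonneg ge) simp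
  show 1: "p \<le> \<epsilon> powr (umax N M mu n - util N mu n a)"
    using le ge unfolding p_def by (intro mult_left_le_one_le) auto
  also have "\<dots> \<le> 1" using util_le_umax[OF assms(1)] by (intro powr_le1) auto
  finally show "p \<le> 1" .
qed

lemma upd_prob_bounds:
  assumes "a \<in> profiles N M" "n \<in> {1..N}"
  shows "0 \<le> upd_prob N M mu \<epsilon> n s a s'" "upd_prob N M mu \<epsilon> n s a s' \<le> 1"
  using content_prob_bounds[OF assms] by (auto simp: upd_prob_def Let_def)

lemma GoT_P_nonneg: "0 \<le> GoT_P N M mu c \<epsilon> z z'"
  unfolding GoT_P_def
  by (intro sum_nonneg mult_nonneg_nonneg prod_nonneg) (auto intro: act_prob_bounds upd_prob_bounds)

lemma sum_act_prob:
  assumes "fst s \<in> {1..M}"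
  shows "(\<Sum>b\<in>{1..M}. act_prob M c \<epsilon> s b) = 1"
proof (cases "snd s")
  case True
  have "(\<Sum>b\<in>{1..M}. act_prob M c \<epsilon> s b)
      = act_prob M c \<epsilon> s (fst s) + (\<Sum>b\<in>{1..M} - {fst s}. act_prob M c \<epsilon> s b)"
    using assms by (intro sum.remove) auto
  also have "(\<Sum>b\<in>{1..M} - {fst s}. act_prob M c \<epsilon> s b)
      = (\<Sum>b\<in>{1..M} - {fst s}. \<epsilon> powr c / (real M - 1))"
    using True by (intro sum.cong) (auto simp: act_prob_def)
  also have "\<dots> = \<epsilon> powr c" using assms M2 by (simp add: of_nat_diff)
  finally show ?thesis using True by (simp add: act_prob_def)
next
  case False
  then show ?thesis using M2 by (simp add: act_prob_def)
qed

lemma sum_upd_prob: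
  assumes "fst s \<in> {1..M}" "a n \<in> {1..M}"
  shows "(\<Sum>s'\<in>{1..M} \<times> UNIV. upd_prob N M mu \<epsilon> n s a s') = 1"
proof (cases "snd s \<and> a n = fst s \<and> util N mu n a > 0")
  case True
  then have "(\<Sum>s'\<in>{1..M} \<times> UNIV. upd_prob N M mu \<epsilon> n s a s')
    = (\<Sum>s'\<in>{1..M} \<times> UNIV. if s' = (fst s, True) then 1 else 0)"
    by (intro sum.cong) (auto simp: upd_prob_def)
  then show ?thesis using assms by simp
next
  case False
  define p where "p = util N mu n a / umax N M mu n * \<epsilon> powr (umax N M mu n - util N mu n a)"
  have "(\<Sum>s'\<in>{1..M} \<times> UNIV. upd_prob N M mu \<epsilon> n s a s')
    = (\<Sum>s'\<in>{1..M} \<times> UNIV. (if s' = (a n, True) then p else 0) +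
        (if s' = (a n, False) then 1 - p else 0))"
    using False by (intro sum.cong) (auto simp: upd_prob_def Let_def p_def)
  then show ?thesis using assms by (simp add: sum.distrib)
qed

text \<open>Given the played profile, players update independently, so the sum over successor states
  factors into one sum per player; the sum over profiles factors likewise.\<close>

lemma GoT_P_row_sum:
  assumes "z \<in> states N M"
  shows "(\<Sum>z'\<in>states N M. GoT_P N M mu c \<epsilon> z z') = 1"
proof -
  let ?A = "\<lambda>a. \<Prod>n\<in>{1..N}. act_prob M c \<epsilon> (z n) (a n)"
  have "(\<Sum>z'\<in>states N M. GoT_P N M mu c \<epsilon> z z') = (\<Sum>a\<in>profiles N M. ?A a *
      (\<Sum>z'\<in>states N M. \<Prod>n\<in>{1..N}. upd_prob N M mu \<epsilon> n (z n) a (z' n)))"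
    unfolding GoT_P_def sum_distrib_left by (rule sum.swap)
  also have "\<dots> = (\<Sum>a\<in>profiles N M. ?A a)"
  proof (intro sum.cong refl)
    fix a assume a: "a \<in> profiles N M"
    have "(\<Sum>z'\<in>states N M. \<Prod>n\<in>{1..N}. upd_prob N M mu \<epsilon> n (z n) a (z' n))
      = (\<Prod>n\<in>{1..N}. \<Sum>s'\<in>{1..M} \<times> UNIV. upd_prob N M mu \<epsilon> n (z n) a s')"
      unfolding states_def by (rule prod_sum_PiE[symmetric]) auto
    also have "\<dots> = 1" using sum_upd_prob state_arm[OF assms] profile_arm[OF a] by simp
    finally show "?A a * (\<Sum>z'\<in>states N M. \<Prod>n\<in>{1..N}. upd_prob N M mu \<epsilon> n (z n) a (z' n)) = ?A a"
      by simp
  qed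
  also have "\<dots> = (\<Prod>n\<in>{1..N}. \<Sum>b\<in>{1..M}. act_prob M c \<epsilon> (z n) b)"
    unfolding profiles_def by (rule prod_sum_PiE[symmetric]) auto
  also have "\<dots> = 1" using sum_act_prob state_arm[OF assms] by simp
  finally show ?thesis .
qed

lemma GoT_P_ge_term:
  assumes "a \<in> profiles N M"
  shows "(\<Prod>n\<in>{1..N}. act_prob M c \<epsilon> (z n) (a n)) *
    (\<Prod>n\<in>{1..N}. upd_prob N M mu \<epsilon> n (z n) a (z' n)) \<le> GoT_P N M mu c \<epsilon> z z'"
  unfolding GoT_P_def using assms finite_profiles
  by (intro member_le_sum[where f = "\<lambda>a. (\<Prod>n\<in>{1..N}. act_prob M c \<epsilon> (z n) (a n)) *
    (\<Prod>n\<in>{1..N}. upd_prob N M mu \<epsilon> n (z n) a (z' n))"] mult_nonneg_nonneg prod_nonneg)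
    (auto intro: act_prob_bounds upd_prob_bounds)


section \<open>The weights \<open>\<epsilon> powr total_cost z\<close>\<close>

text \<open>The one-player form of the inflow bound. A discontent target has cost 0, an unchanged
  state keeps its cost, and a newly content player pays its new cost through the update probability
  itself.\<close>

lemma upd_prob_cost:
  assumes "a \<in> profiles N M" "n \<in> {1..N}" "y \<in> states N M"
  shows "upd_prob N M mu \<epsilon> n (y n) a s * \<epsilon> powr cost n (y n) \<le> \<epsilon> powr cost n s"
proof -
  have y1: "\<epsilon> powr cost n (y n) \<le> 1" using cost_nonneg[OF assms(3,2)] by (rule powr_le1)
  let ?u = "upd_prob N M mu \<epsilon> n (y n) a s"
  note ub = upd_prob_bounds[OF assms(1,2), of "y n" s]
  show ?thesis
  proof (cases "s = y n \<or> \<not> snd s")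
    case True
    then show ?thesis
    proof
      assume "s = y n"
      then show ?thesis using ub by (auto intro: mult_left_le_one_le)
    next
      assume "\<not> snd s"
      then show ?thesis using ub y1 by (auto simp: cost_def intro: mult_le_one)
    qed
  next
    case False
    have "?u \<le> \<epsilon> powr cost n s"
    proof (cases "?u = 0")
      case nz: False
      \<comment> \<open>Since \<open>s\<close> is content and differs from \<open>y n\<close>, only
        the branch of a random update to contentment remains.\<close>
      then have s: "s = (a n, True)"
        and u: "?u = util N mu n a / umax N M mu n * \<epsilon> powr (umax N M mu n - util N mu n a)"
        using False by (auto simp: upd_prob_def Let_def prod_eq_iff split: if_splits)
      then have "util N mu n a > 0" using nz util_nonneg[OF assms(1,2)] by (cases "util N mu n a = 0") auto
      then have "util N mu n a = mu n (a n)" by (rule util_pos_eq[OF assms(2)])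
      then show ?thesis using s u content_prob_bounds(3)[OF assms(1,2)] by (simp add: cost_def)
    qed simp
    then show ?thesis using ub y1 by (meson mult_left_le order_trans powr_ge_zero)
  qed
qed

lemma powr_total_cost: "\<epsilon> powr total_cost z = (\<Prod>n\<in>{1..N}. \<epsilon> powr cost n (z n))"
  using eps_pos by (simp add: total_cost_def powr_sum)

text \<open>A settled state is left only by an experiment of probability of order
  \<open>\<epsilon> powr c\<close>. The shift by \<open>c\<close> compensates for this, so that
  weight times escape rate has order \<open>\<epsilon> powr total_cost z\<close> in either
  case.\<close>

definition weight :: "(nat \<Rightarrow> nat \<times> bool) \<Rightarrow> real" where
  "weight z = \<epsilon> powr (total_cost z - (if settled z then c else 0))"

lemma weight_pos: "0 < weight z"
  using eps_pos by (simp add: weight_def)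

text \<open>The bound holds for each of the \<open>M ^ N\<close> played profiles separately: the
  updates are controlled by \<open>upd_prob_cost\<close>, and for settled \<open>y\<close> the
  forced experiment absorbs the shift by \<open>c\<close> in the weight.\<close>

lemma GoT_P_inflow:
  assumes x: "x \<in> states N M" and y: "y \<in> states N M" and "x \<noteq> y"
  shows "weight y * GoT_P N M mu c \<epsilon> y x \<le> real (M ^ N) * \<epsilon> powr total_cost x"
proof -
  let ?s = "if settled y then \<epsilon> powr c else 1"
  let ?A = "\<lambda>a. \<Prod>n\<in>{1..N}. act_prob M c \<epsilon> (y n) (a n)"
  let ?U = "\<lambda>a. \<Prod>n\<in>{1..N}. upd_prob N M mu \<epsilon> n (y n) a (x n)"
  have wy: "weight y * ?s = \<epsilon> powr total_cost y"
    using eps_pos by (simp add: weight_def powr_diff)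
  have s_pos: "0 < ?s" using eps_pos by simp
  have "?A a * ?U a * \<epsilon> powr total_cost y \<le> ?s * \<epsilon> powr total_cost x"
    if a: "a \<in> profiles N M" for a
  proof (cases "?U a = 0")
    case False
    have A1: "?A a \<le> 1" by (intro prod_le_1) (auto intro: act_prob_bounds)
    have "?A a \<le> ?s"
    proof (cases "settled y")
      case True
      \<comment> \<open>If all players of a settled state repeat their baselines, all utilities are
        positive and the state stays put, against \<open>x \<noteq> y\<close>.\<close>
      have "\<exists>j\<in>{1..N}. a j \<noteq> fst (y j)"
      proof (rule ccontr)
        assume "\<not> ?thesis"
        then have ay: "\<And>n. n \<in> {1..N} \<Longrightarrow> a n = fst (y n)" by auto
        have "x n = y n" if n: "n \<in> {1..N}" for n
        proof -
          have "util N mu n a = mu n (a n)"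
            using True n ay by (auto simp: util_eq settled_def dest: inj_onD)
          then have "util N mu n a > 0" using mu_pos[OF n profile_arm[OF a n]] by simp
          moreover have "upd_prob N M mu \<epsilon> n (y n) a (x n) \<noteq> 0" using False n by auto
          moreover have "snd (y n)" using True n by (simp add: settled_def)
          ultimately show ?thesis using ay[OF n]
            by (auto simp: upd_prob_def prod_eq_iff split: if_splits)
        qed
        then show False using states_eqI[OF x y] \<open>x \<noteq> y\<close> by blast
      qed
      then obtain j where j: "j \<in> {1..N}" "a j \<noteq> fst (y j)" by blast
      have "?A a = act_prob M c \<epsilon> (y j) (a j) * (\<Prod>n\<in>{1..N} - {j}. act_prob M c \<epsilon> (y n) (a n))"
        using j by (intro prod.remove) auto
      also have "\<dots> \<le> act_prob M c \<epsilon> (y j) (a j) * 1"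
        by (intro mult_left_mono prod_le_1) (auto intro: act_prob_bounds)
      also have "\<dots> \<le> \<epsilon> powr c"
        using act_prob_deviate_le[of "y j" "a j"] True j by (auto simp: settled_def)
      finally show ?thesis using True by simp
    qed (use A1 in simp)
    moreover have "?U a * \<epsilon> powr total_cost y \<le> \<epsilon> powr total_cost x"
      unfolding powr_total_cost prod.distrib[symmetric]
      by (intro prod_mono conjI mult_nonneg_nonneg upd_prob_cost a y)
        (auto intro: upd_prob_bounds a)
    ultimately have "?A a * (?U a * \<epsilon> powr total_cost y) \<le> ?s * \<epsilon> powr total_cost x"
      using s_pos by (intro mult_mono mult_nonneg_nonneg prod_nonneg)
        (auto intro: upd_prob_bounds a)
    then show ?thesis by (simp add: mult.assoc)
  next
    case True
    then show ?thesis using s_pos by (simp only: mult_zero_right mult_zero_left) simp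
  qed
  then have "(\<Sum>a\<in>profiles N M. ?A a * ?U a * \<epsilon> powr total_cost y)
      \<le> (\<Sum>a\<in>profiles N M. ?s * \<epsilon> powr total_cost x)"
    by (rule sum_mono)
  then have "weight y * ?s * GoT_P N M mu c \<epsilon> y x \<le> real (M ^ N) * (?s * \<epsilon> powr total_cost x)"
    unfolding wy GoT_P_def sum_constant card_profiles
    by (simp only: sum_distrib_left mult.commute)
  then have "?s * (weight y * GoT_P N M mu c \<epsilon> y x) \<le> ?s * (real (M ^ N) * \<epsilon> powr total_cost x)"
    by (simp only: mult_ac)
  then show ?thesis using s_pos by (simp only: mult_le_cancel_left_pos)
qed

section \<open>Escape moves towards the state with all players discontent\<close>

text \<open>The successor of z under the played profile a when no player turns content.\<close>

definition disturb :: "(nat \<Rightarrow> nat \<times> bool) \<Rightarrow> (nat \<Rightarrow> nat) \<Rightarrow> nat \<Rightarrow> nat \<times> bool" where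
  "disturb z a = (\<lambda>n\<in>{1..N}.
     if snd (z n) \<and> a n = fst (z n) \<and> util N mu n a > 0 then z n else (a n, False))"

definition content :: "(nat \<Rightarrow> nat \<times> bool) \<Rightarrow> nat set" where
  "content z = {n \<in> {1..N}. snd (z n)}"

text \<open>The reference state \<open>d\<close> of the comparison. All baselines agree, so that a
  collision of all players on one arm leads there from any state without content players.\<close>

definition bottom :: "nat \<Rightarrow> nat \<times> bool" where
  "bottom = (\<lambda>n\<in>{1..N}. (1, False))"

lemma disturb_in_states:
  "z \<in> states N M \<Longrightarrow> a \<in> profiles N M \<Longrightarrow> disturb z a \<in> states N M"
  unfolding disturb_def using state_arm profile_arm by (intro restrict_in_states) auto

lemma bottom_in_states: "bottom \<in> states N M"
  unfolding bottom_def using M2 by (intro restrict_in_states) auto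

lemma total_cost_disturb:
  assumes "z \<in> states N M"
  shows "total_cost (disturb z a) \<le> total_cost z"
  unfolding total_cost_def
  by (intro sum_mono) (auto simp: disturb_def cost_def[of _ "(_, False)"] intro: cost_nonneg[OF assms])

text \<open>The assumption leaves no randomness in the updates: at utility 0 contentment has
  probability 0, and otherwise a content player keeps its state. Only the action probabilities
  remain.\<close>

lemma GoT_P_disturb:
  assumes a: "a \<in> profiles N M"
    and H: "\<And>n. n \<in> {1..N} \<Longrightarrow> util N mu n a = 0 \<or> snd (z n) \<and> a n = fst (z n)"
  shows "(\<Prod>n\<in>{1..N}. act_prob M c \<epsilon> (z n) (a n)) \<le> GoT_P N M mu c \<epsilon> z (disturb z a)"
proof -
  have "upd_prob N M mu \<epsilon> n (z n) a (disturb z a n) = 1" if n: "n \<in> {1..N}" for n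
    using H[OF n] util_nonneg[OF a n] n
    by (auto simp: upd_prob_def disturb_def prod_eq_iff Let_def)
  then show ?thesis using GoT_P_ge_term[OF a, of z "disturb z a"] by simp
qed

lemma card_content_disturb:
  assumes "j \<in> content z" "util N mu j a = 0 \<or> a j \<noteq> fst (z j)"
  shows "card (content (disturb z a)) < card (content z)"
proof (rule psubset_card_mono)
  show "finite (content z)" by (simp add: content_def)
  have "content (disturb z a) \<subseteq> content z"
    by (auto simp: content_def disturb_def split: if_splits)
  moreover have "j \<notin> content (disturb z a)" using assms by (auto simp: content_def disturb_def)
  ultimately show "content (disturb z a) \<subset> content z" using assms(1) by blast
qed

lemma act_prob_ge:
  assumes "\<epsilon> powr c \<le> 1 / 2" "\<not> snd s \<or> b = fst s"
  shows "1 / real M \<le> act_prob M c \<epsilon> s b"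
proof -
  have "1 / real M \<le> 1 / 2" using M2 by (intro divide_left_mono) auto
  then show ?thesis using assms by (auto simp: act_prob_def)
qed

text \<open>A collision can always be arranged that removes a content player or, if there is none,
  leads to \<open>bottom\<close>. Unless the state is settled, no content player has to deviate for
  it.\<close>

lemma exists_disturbance:
  assumes z: "z \<in> states N M" "z \<noteq> bottom" and small: "\<epsilon> powr c \<le> 1 / 2"
  obtains a where "a \<in> profiles N M"
    "\<And>n. n \<in> {1..N} \<Longrightarrow> util N mu n a = 0 \<or> snd (z n) \<and> a n = fst (z n)"
    "(1 / real M) ^ N * (if settled z then \<epsilon> powr c else 1)
       \<le> (\<Prod>n\<in>{1..N}. act_prob M c \<epsilon> (z n) (a n))"
    "(\<exists>j\<in>content z. util N mu j a = 0 \<or> a j \<noteq> fst (z j)) \<or>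
       content z = {} \<and> disturb z a = bottom"
proof -
  \<comment> \<open>Without deviations of content players every action has probability at least
    \<open>1 / M\<close>.\<close>
  have unsettled: "(1 / real M) ^ N * (if settled z then \<epsilon> powr c else 1)
       \<le> (\<Prod>n\<in>{1..N}. act_prob M c \<epsilon> (z n) (a n))"
    if "\<not> settled z" "\<And>n. n \<in> {1..N} \<Longrightarrow> \<not> snd (z n) \<or> a n = fst (z n)" for a
  proof -
    have "(\<Prod>n\<in>{1..N}. 1 / real M) \<le> (\<Prod>n\<in>{1..N}. act_prob M c \<epsilon> (z n) (a n))"
      using that by (intro prod_mono conjI act_prob_ge small) auto
    then show ?thesis using that(1) by simp
  qed
  consider (empty) "content z = {}"
    | (mixed) j k where "j \<in> content z" "k \<in> {1..N}" "\<not> snd (z k)"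
    | (full) "content z = {1..N}"
    unfolding content_def by blast
  then show thesis
  proof cases
    case empty
    let ?a = "\<lambda>n\<in>{1..N}. 1 :: nat"
    have D: "\<not> snd (z n)" if "n \<in> {1..N}" for n using empty that by (auto simp: content_def)
    have u: "util N mu n ?a = 0" if n: "n \<in> {1..N}" for n
      using n N2 by (intro util_collide[of n "if n = 1 then 2 else 1"]) auto
    show thesis
    proof (rule that[of ?a])
      show "?a \<in> profiles N M" using M2 by (intro restrict_in_profiles) auto
      show "(1 / real M) ^ N * (if settled z then \<epsilon> powr c else 1)
         \<le> (\<Prod>n\<in>{1..N}. act_prob M c \<epsilon> (z n) (?a n))"
        using D N2 by (intro unsettled) (auto simp: settled_def)
      have "disturb z ?a = bottom" unfolding disturb_def bottom_def
        by (rule restrict_ext) (use D in auto)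
      then show "(\<exists>j\<in>content z. util N mu j ?a = 0 \<or> ?a j \<noteq> fst (z j)) \<or>
        content z = {} \<and> disturb z ?a = bottom" using empty by simp
    qed (use u in blast)
  next
    case mixed
    have j: "j \<in> {1..N}" "snd (z j)" using mixed by (auto simp: content_def)
    \<comment> \<open>All discontent players, among them \<open>k\<close>, jump onto the arm of the
      content player \<open>j\<close>, so they and \<open>j\<close> get utility 0.\<close>
    let ?a = "\<lambda>n\<in>{1..N}. if snd (z n) then fst (z n) else fst (z j)"
    have u: "util N mu n ?a = 0" if "n \<in> {1..N}" "\<not> snd (z n) \<or> n = j" for n
    proof -
      have "k \<noteq> j" "?a k = ?a j" using mixed(2,3) j by auto
      moreover have "?a n = ?a j" using that j by auto
      ultimately show ?thesis
        using util_collide[OF that(1) mixed(2), of ?a] util_collide[OF that(1) j(1), of ?a]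
        by (cases "n = j") simp_all
    qed
    show thesis
    proof (rule that[of ?a])
      show "?a \<in> profiles N M" using state_arm[OF z(1)] j by (intro restrict_in_profiles) auto
      show "(1 / real M) ^ N * (if settled z then \<epsilon> powr c else 1)
         \<le> (\<Prod>n\<in>{1..N}. act_prob M c \<epsilon> (z n) (?a n))"
        using mixed by (intro unsettled) (auto simp: settled_def)
      show "util N mu n ?a = 0 \<or> snd (z n) \<and> ?a n = fst (z n)" if "n \<in> {1..N}" for n
        using u[OF that] that by auto
      show "(\<exists>j\<in>content z. util N mu j ?a = 0 \<or> ?a j \<noteq> fst (z j)) \<or>
        content z = {} \<and> disturb z ?a = bottom" using u[OF j(1)] mixed(1) by auto
    qed
  next
    case full
    have C: "snd (z n)" if "n \<in> {1..N}" for n using full that unfolding content_def by blast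
    show thesis
    proof (cases "settled z")
      case False
      \<comment> \<open>All players are content but two baselines coincide, so repeating the
        baselines already produces a collision.\<close>
      let ?a = "\<lambda>n\<in>{1..N}. fst (z n)"
      obtain i j where ij: "i \<in> {1..N}" "j \<in> {1..N}" "i \<noteq> j" "fst (z i) = fst (z j)"
        using False C by (auto simp: settled_def inj_on_def)
      show thesis
      proof (rule that[of ?a])
        show "?a \<in> profiles N M" using state_arm[OF z(1)] by (intro restrict_in_profiles) auto
        show "(1 / real M) ^ N * (if settled z then \<epsilon> powr c else 1)
           \<le> (\<Prod>n\<in>{1..N}. act_prob M c \<epsilon> (z n) (?a n))"
          using False by (intro unsettled) auto
        show "util N mu n ?a = 0 \<or> snd (z n) \<and> ?a n = fst (z n)" if "n \<in> {1..N}" for n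
          using C[OF that] that by auto
        have "util N mu i ?a = 0" using ij by (intro util_collide[of i j]) auto
        then show "(\<exists>j\<in>content z. util N mu j ?a = 0 \<or> ?a j \<noteq> fst (z j)) \<or>
          content z = {} \<and> disturb z ?a = bottom" using ij(1) full by blast
      qed
    next
      case True
      \<comment> \<open>The only case with an experiment: player 1 moves onto the arm of player 2,
        which accounts for the factor \<open>\<epsilon> powr c\<close>.\<close>
      let ?a = "\<lambda>n\<in>{1..N}. if n = 1 then fst (z 2) else fst (z n)"
      have 12: "1 \<in> {1..N}" "2 \<in> {1..N}" using N2 by auto
      have ne: "fst (z 2) \<noteq> fst (z 1)"
        using True 12 unfolding settled_def by (metis inj_onD numeral_eq_one_iff semiring_norm(85))
      show thesis
      proof (rule that[of ?a])
        show "?a \<in> profiles N M" using state_arm[OF z(1)] 12 by (intro restrict_in_profiles) auto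
        have 1: "act_prob M c \<epsilon> (z 1) (?a 1) \<ge> 1 / real M * \<epsilon> powr c"
        proof -
          have "\<epsilon> powr c / real M \<le> \<epsilon> powr c / (real M - 1)"
            using M2 by (intro divide_left_mono) auto
          then show ?thesis using C[OF 12(1)] ne 12 by (simp add: act_prob_def)
        qed
        have "(\<Prod>n\<in>{1..N}. 1 / real M * (if n = 1 then \<epsilon> powr c else 1))
          \<le> (\<Prod>n\<in>{1..N}. act_prob M c \<epsilon> (z n) (?a n))"
        proof (intro prod_mono conjI)
          fix n assume n: "n \<in> {1..N}"
          show "1 / real M * (if n = 1 then \<epsilon> powr c else 1) \<le> act_prob M c \<epsilon> (z n) (?a n)"
            using 1 act_prob_ge[OF small, of "z n" "?a n"] n by (cases "n = 1") auto
        qed auto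
        also have "(\<Prod>n\<in>{1..N}. 1 / real M * (if n = 1 then \<epsilon> powr c else 1))
          = (1 / real M) ^ N * \<epsilon> powr c"
          using 12 by (simp only: prod.distrib prod.delta) simp
        finally show "(1 / real M) ^ N * (if settled z then \<epsilon> powr c else 1)
           \<le> (\<Prod>n\<in>{1..N}. act_prob M c \<epsilon> (z n) (?a n))" using True by simp
        have u: "util N mu 1 ?a = 0" using 12 by (intro util_collide[of 1 2]) auto
        show "util N mu n ?a = 0 \<or> snd (z n) \<and> ?a n = fst (z n)" if "n \<in> {1..N}" for n
          using u C[OF that] that by (cases "n = 1") auto
        show "(\<exists>j\<in>content z. util N mu j ?a = 0 \<or> ?a j \<noteq> fst (z j)) \<or>
          content z = {} \<and> disturb z ?a = bottom" using 12(1) full u by blast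
      qed
    qed
  qed
qed

text \<open>The decreasing rank is the number of content players, plus 1 away from
  \<open>bottom\<close>; the extra 1 makes the final move, made when nobody is content, decrease it
  as well.\<close>

lemma GoT_P_escape:
  assumes z: "z \<in> states N M" "z \<noteq> bottom" and small: "\<epsilon> powr c \<le> 1 / 2"
  shows "\<exists>y\<in>states N M. (1 / real M) ^ N * \<epsilon> powr total_cost z \<le> weight z * GoT_P N M mu c \<epsilon> z y \<and>
    \<epsilon> powr total_cost z \<le> \<epsilon> powr total_cost y \<and>
    card (content y) + (if y = bottom then 0 else 1) < card (content z) + (if z = bottom then 0 else 1)"
proof -
  obtain a where a: "a \<in> profiles N M"
    "\<And>n. n \<in> {1..N} \<Longrightarrow> util N mu n a = 0 \<or> snd (z n) \<and> a n = fst (z n)"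
    "(1 / real M) ^ N * (if settled z then \<epsilon> powr c else 1)
       \<le> (\<Prod>n\<in>{1..N}. act_prob M c \<epsilon> (z n) (a n))"
    "(\<exists>j\<in>content z. util N mu j a = 0 \<or> a j \<noteq> fst (z j)) \<or>
       content z = {} \<and> disturb z a = bottom"
    by (rule exists_disturbance[OF assms]) blast
  let ?s = "if settled z then \<epsilon> powr c else 1"
  let ?y = "disturb z a"
  have "(1 / real M) ^ N * ?s \<le> GoT_P N M mu c \<epsilon> z ?y"
    using a(3) GoT_P_disturb[OF a(1,2)] by linarith
  then have "weight z * ((1 / real M) ^ N * ?s) \<le> weight z * GoT_P N M mu c \<epsilon> z ?y"
    using weight_pos[of z] by (intro mult_left_mono) auto
  moreover have "weight z * ?s = \<epsilon> powr total_cost z"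
    using eps_pos by (simp add: weight_def powr_diff)
  ultimately have "(1 / real M) ^ N * \<epsilon> powr total_cost z \<le> weight z * GoT_P N M mu c \<epsilon> z ?y"
    by (metis mult.left_commute)
  moreover have "\<epsilon> powr total_cost z \<le> \<epsilon> powr total_cost ?y"
    using total_cost_disturb[OF z(1)] eps_pos eps_lt1 by (intro powr_mono') auto
  moreover have "card (content ?y) + (if ?y = bottom then 0 else 1)
      < card (content z) + (if z = bottom then 0 else 1)"
  proof (cases "content z = {}")
    case True
    then have "?y = bottom" using a(4) by auto
    moreover have "content bottom = {}" by (auto simp: content_def bottom_def)
    ultimately show ?thesis using z(2) by simp
  next
    case False
    then obtain j where "j \<in> content z" "util N mu j a = 0 \<or> a j \<noteq> fst (z j)" using a(4) by auto
    then have "card (content ?y) < card (content z)" by (rule card_content_disturb)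
    then show ?thesis using z(2) by (cases "?y = bottom") auto
  qed
  ultimately show ?thesis using disturb_in_states[OF z(1) a(1)] by blast
qed

text \<open>The inflow constant \<open>M ^ N\<close> and the escape constant
  \<open>(1 / M) ^ N\<close> do not involve \<open>\<epsilon>\<close>, so the comparison is uniform
  in \<open>\<epsilon>\<close> and \<open>\<pi>\<close>.\<close>

lemma stationary_le_weight:
  assumes st: "stationary N M mu c \<epsilon> \<pi>" and small: "\<epsilon> powr c \<le> 1 / 2" and x: "x \<in> states N M"
  shows "\<pi> x \<le> max 1 (real (M ^ N) * (real (card (states N M)))\<^sup>2 / (1 / real M) ^ N)
    ^ card (states N M) * \<pi> bottom * weight x"
proof -
  interpret stationary_chain "states N M" "GoT_P N M mu c \<epsilon>" \<pi>
    using st by unfold_locales (auto simp: stationary_def finite_states GoT_P_nonneg GoT_P_row_sum)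
  let ?K = "max 1 (real (M ^ N) * (real (card (states N M)))\<^sup>2 / (1 / real M) ^ N) ^ card (states N M)"
  have "\<pi> x / weight x \<le> ?K * (\<pi> bottom / weight bottom)"
    by (rule weight_comparison[where \<phi> = "\<lambda>x. \<epsilon> powr total_cost x" and
          m = "\<lambda>y. card (content y) + (if y = bottom then 0 else 1)",
          OF weight_pos _ GoT_P_inflow GoT_P_escape _ _ bottom_in_states x])
      (use eps_pos M2 small in auto)
  moreover have "weight bottom = 1"
    using N2 eps_pos by (auto simp: weight_def total_cost_def settled_def bottom_def cost_def)
  ultimately show ?thesis using weight_pos[of x] by (simp add: pos_divide_le_eq)
qed

end

section \<open>Concentration on the optimal state\<close>

locale got_opt = got +
  fixes astar :: "nat \<Rightarrow> nat"
  assumes astar: "astar \<in> profiles N M"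
    and unique_max: "\<And>a. a \<in> profiles N M \<Longrightarrow> a \<noteq> astar \<Longrightarrow>
      (\<Sum>n\<in>{1..N}. util N mu n a) < (\<Sum>n\<in>{1..N}. util N mu n astar)"
    and c_large: "(\<Sum>n\<in>{1..N}. umax N M mu n) - (\<Sum>n\<in>{1..N}. util N mu n astar) < c"
begin

text \<open>If two players collided, some arm would be free because \<open>N \<le> M\<close>. Moving
  one of them there changes the profile and lowers nobody's utility, contradicting strict
  maximality.\<close>

lemma inj_astar: "inj_on astar {1..N}"
proof (rule ccontr)
  assume "\<not> ?thesis"
  then obtain i j where ij: "i \<in> {1..N}" "j \<in> {1..N}" "i \<noteq> j" "astar i = astar j"
    by (auto simp: inj_on_def)
  have "card (astar ` {1..N}) < card {1..N}"
    using \<open>\<not> inj_on astar {1..N}\<close> by (meson card_image_le eq_card_imp_inj_on finite_atLeastAtMost le_neq_implies_less)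
  then have "card (astar ` {1..N}) < card {1..M}" using NM by simp
  then obtain b where b: "b \<in> {1..M}" "b \<notin> astar ` {1..N}"
    by (metis card_mono finite_imageI finite_atLeastAtMost leD subsetI)
  let ?a = "astar(i := b)"
  have a: "?a \<in> profiles N M" using astar b ij(1) by (auto simp: profiles_def PiE_def extensional_def)
  have "?a \<noteq> astar" using b ij(1) by (metis fun_upd_same image_eqI)
  moreover have "(\<Sum>n\<in>{1..N}. util N mu n astar) \<le> (\<Sum>n\<in>{1..N}. util N mu n ?a)"
  proof (rule sum_mono)
    fix n assume n: "n \<in> {1..N}"
    show "util N mu n astar \<le> util N mu n ?a"
    proof (cases "n = i \<or> util N mu n astar = 0")
      case True
      moreover have "util N mu i astar = 0"
        using ij by (intro util_collide[of i j]) auto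
      ultimately have "util N mu n astar = 0" by auto
      then show ?thesis using util_nonneg[OF a n] by simp
    next
      case False
      then show ?thesis using n b by (auto simp: util_eq split: if_splits)
    qed
  qed
  ultimately show False using unique_max[OF a] by simp
qed

lemma util_astar: "n \<in> {1..N} \<Longrightarrow> util N mu n astar = mu n (astar n)"
  using inj_astar by (auto simp: util_eq dest: inj_onD)

lemma util_astar_pos: "n \<in> {1..N} \<Longrightarrow> 0 < util N mu n astar"
  using mu_pos profile_arm[OF astar] by (simp add: util_astar)

definition zstar :: "nat \<Rightarrow> nat \<times> bool" where
  "zstar = (\<lambda>n\<in>{1..N}. (astar n, True))"

lemma zstar_in_states: "zstar \<in> states N M"
  unfolding zstar_def using profile_arm[OF astar] by (intro restrict_in_states) auto

lemma total_cost_zstar: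
  "total_cost zstar = (\<Sum>n\<in>{1..N}. umax N M mu n - util N mu n astar)"
  unfolding total_cost_def
  by (intro sum.cong) (auto simp: cost_def zstar_def util_astar)

lemma total_cost_zstar_less: "total_cost zstar < c"
  using c_large by (simp add: total_cost_zstar sum_subtractf)

text \<open>On settled states the total cost is the sum of all \<open>umax\<close> minus the total
  utility of the baseline profile, so minimising cost means maximising total utility.\<close>

lemma total_cost_zstar_min:
  assumes "z \<in> states N M" "settled z" "z \<noteq> zstar"
  shows "total_cost zstar < total_cost z"
proof -
  let ?a = "\<lambda>n\<in>{1..N}. fst (z n)"
  have a: "?a \<in> profiles N M" using state_arm[OF assms(1)] by (intro restrict_in_profiles)
  have "?a \<noteq> astar"
  proof
    assume eq: "?a = astar"
    have "z n = zstar n" if "n \<in> {1..N}" for n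
      using that assms(2) fun_cong[OF eq, of n] by (auto simp: settled_def zstar_def prod_eq_iff)
    then show False using states_eqI[OF assms(1) zstar_in_states] assms(3) by blast
  qed
  then have "(\<Sum>n\<in>{1..N}. util N mu n ?a) < (\<Sum>n\<in>{1..N}. util N mu n astar)"
    by (rule unique_max[OF a])
  moreover have "total_cost z = (\<Sum>n\<in>{1..N}. umax N M mu n - util N mu n ?a)"
    unfolding total_cost_def using assms(2)
    by (intro sum.cong) (auto simp: cost_def util_eq settled_def dest: inj_onD)
  ultimately show ?thesis by (simp add: total_cost_zstar sum_subtractf)
qed

text \<open>The exponent of \<open>\<epsilon>\<close> in the ratio of the weights of
  \<open>z\<close> and \<open>zstar\<close>.\<close>

definition excess :: "(nat \<Rightarrow> nat \<times> bool) \<Rightarrow> real" where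
  "excess z = total_cost z - (if settled z then c else 0) + (c - total_cost zstar)"

text \<open>Settled states lose against \<open>zstar\<close> by the uniqueness of the maximiser,
  unsettled ones by the lower bound on \<open>c\<close>.\<close>

lemma excess_pos:
  assumes "z \<in> states N M" "z \<noteq> zstar"
  shows "0 < excess z"
  using total_cost_zstar_min[OF assms(1) _ assms(2)] total_cost_nonneg[OF assms(1)]
    total_cost_zstar_less by (auto simp: excess_def)

end

section \<open>The balance equation at the optimal state\<close>

locale got_opt_eps = got_opt + got_eps
begin

text \<open>One step suffices: all players draw their arm of \<open>astar\<close>, each with
  probability \<open>1 / M\<close>, and all turn content.\<close>

lemma GoT_P_bottom_zstar:
  "(\<Prod>n\<in>{1..N}. util N mu n astar / umax N M mu n / real M) * \<epsilon> powr total_cost zstar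
    \<le> GoT_P N M mu c \<epsilon> bottom zstar"
proof -
  have "(\<Prod>n\<in>{1..N}. act_prob M c \<epsilon> (bottom n) (astar n)) *
      (\<Prod>n\<in>{1..N}. upd_prob N M mu \<epsilon> n (bottom n) astar (zstar n))
    = (\<Prod>n\<in>{1..N}. util N mu n astar / umax N M mu n / real M * \<epsilon> powr cost n (zstar n))"
    unfolding prod.distrib[symmetric]
    by (intro prod.cong)
      (auto simp: act_prob_def upd_prob_def bottom_def zstar_def cost_def util_astar Let_def)
  then show ?thesis using GoT_P_ge_term[OF astar, of bottom zstar]
    by (simp only: powr_total_cost prod.distrib)
qed

lemma GoT_P_zstar_zstar: "1 - real N * \<epsilon> powr c \<le> GoT_P N M mu c \<epsilon> zstar zstar"
proof -
  \<comment> \<open>Bernoulli's inequality bounds below the probability that nobody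
    experiments.\<close>
  have "1 + real N * (- (\<epsilon> powr c)) \<le> (1 + - (\<epsilon> powr c)) ^ N"
    using powr_le1[of c] c_pos by (intro Bernoulli_inequality) auto
  also have "\<dots> = (\<Prod>n\<in>{1..N}. act_prob M c \<epsilon> (zstar n) (astar n)) *
      (\<Prod>n\<in>{1..N}. upd_prob N M mu \<epsilon> n (zstar n) astar (zstar n))"
    using util_astar_pos by (simp add: act_prob_def upd_prob_def zstar_def)
  also have "\<dots> \<le> GoT_P N M mu c \<epsilon> zstar zstar" by (rule GoT_P_ge_term[OF astar])
  finally show ?thesis by simp
qed

text \<open>In the balance equation at \<open>zstar\<close> only the terms of \<open>zstar\<close>
  and \<open>bottom\<close> are kept: the flow from \<open>bottom\<close> cannot exceed the outflow
  from \<open>zstar\<close>, which is at most \<open>N * \<epsilon> powr c\<close> times its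
  mass.\<close>

lemma bottom_le_zstar:
  assumes st: "stationary N M mu c \<epsilon> \<pi>"
  shows "\<pi> bottom \<le> real N / (\<Prod>n\<in>{1..N}. util N mu n astar / umax N M mu n / real M) *
    \<epsilon> powr (c - total_cost zstar) * \<pi> zstar"
proof -
  let ?k = "\<Prod>n\<in>{1..N}. util N mu n astar / umax N M mu n / real M"
  have k: "0 < ?k" using util_astar_pos umax_pos M2 by (intro prod_pos) auto
  have nn: "\<And>z. z \<in> states N M \<Longrightarrow> 0 \<le> \<pi> z"
    and bal: "(\<Sum>z\<in>states N M. \<pi> z * GoT_P N M mu c \<epsilon> z zstar) = \<pi> zstar"
    using st zstar_in_states by (auto simp: stationary_def)
  have ne: "zstar \<noteq> bottom"
    using N2 by (auto simp: zstar_def bottom_def fun_eq_iff intro!: exI[of _ 1])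
  have "\<pi> zstar * (1 - real N * \<epsilon> powr c) + \<pi> bottom * (?k * \<epsilon> powr total_cost zstar)
    \<le> \<pi> zstar * GoT_P N M mu c \<epsilon> zstar zstar + \<pi> bottom * GoT_P N M mu c \<epsilon> bottom zstar"
    using GoT_P_bottom_zstar GoT_P_zstar_zstar nn[OF zstar_in_states] nn[OF bottom_in_states]
    by (intro add_mono mult_left_mono) auto
  also have "\<dots> = (\<Sum>z\<in>{zstar, bottom}. \<pi> z * GoT_P N M mu c \<epsilon> z zstar)" using ne by simp
  also have "\<dots> \<le> (\<Sum>z\<in>states N M. \<pi> z * GoT_P N M mu c \<epsilon> z zstar)"
    using finite_states zstar_in_states bottom_in_states nn GoT_P_nonneg
    by (intro sum_mono2) auto
  finally have "\<pi> bottom * (?k * \<epsilon> powr total_cost zstar) \<le> real N * \<epsilon> powr c * \<pi> zstar"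
    unfolding bal by (simp add: algebra_simps)
  then have "\<pi> bottom \<le> real N * \<epsilon> powr c * \<pi> zstar / (?k * \<epsilon> powr total_cost zstar)"
    using k eps_pos by (subst pos_le_divide_eq) auto
  then show ?thesis by (simp add: powr_diff)
qed

end

section \<open>Uniform bounds and the limit of small \<open>\<epsilon>\<close>\<close>

context got_opt
begin

text \<open>The upper bound through \<open>bottom\<close> and the bound of \<open>bottom\<close> by
  \<open>zstar\<close> are chained; their exponents add up to \<open>excess\<close>.
  \<open>K\<close> is fixed before \<open>\<epsilon>\<close> and \<open>\<pi>\<close>, as the limit
  requires.\<close>

lemma stationary_le_zstar:
  obtains K where "0 < K"
    "\<And>\<epsilon> \<pi> x. 0 < \<epsilon> \<Longrightarrow> \<epsilon> < 1 \<Longrightarrow> \<epsilon> powr c \<le> 1 / 2 \<Longrightarrow> stationary N M mu c \<epsilon> \<pi> \<Longrightarrow>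
       x \<in> states N M \<Longrightarrow> \<pi> x \<le> K * \<epsilon> powr excess x * \<pi> zstar"
proof -
  define K1 where "K1 = max 1 (real (M ^ N) * (real (card (states N M)))\<^sup>2 / (1 / real M) ^ N)
    ^ card (states N M)"
  define K2 where "K2 = real N / (\<Prod>n\<in>{1..N}. util N mu n astar / umax N M mu n / real M)"
  have K1: "0 < K1" unfolding K1_def by (intro zero_less_power) auto
  have K2: "0 < K2" unfolding K2_def using util_astar_pos umax_pos M2 N2
    by (intro divide_pos_pos prod_pos) auto
  show thesis
  proof (rule that[of "K1 * K2"])
    fix \<epsilon> \<pi> x
    assume eps: "0 < \<epsilon>" "\<epsilon> < 1" "\<epsilon> powr c \<le> 1 / 2" and st: "stationary N M mu c \<epsilon> \<pi>"
      and x: "x \<in> states N M"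
    interpret got_opt_eps N M mu c astar \<epsilon> using eps by unfold_locales
    have "\<pi> x \<le> K1 * \<pi> bottom * weight x"
      unfolding K1_def by (rule stationary_le_weight[OF st eps(3) x])
    also have "\<dots> \<le> K1 * (K2 * \<epsilon> powr (c - total_cost zstar) * \<pi> zstar) * weight x"
      using bottom_le_zstar[OF st] K1 weight_pos[of x] unfolding K2_def
      by (intro mult_right_mono mult_left_mono) auto
    also have "\<dots> = K1 * K2 * \<epsilon> powr excess x * \<pi> zstar"
      by (simp add: weight_def excess_def powr_add mult_ac)
    finally show "\<pi> x \<le> K1 * K2 * \<epsilon> powr excess x * \<pi> zstar" .
  qed (use K1 K2 in simp)
qed

lemma tendsto_powr_at_right_0:
  "0 < e \<Longrightarrow> ((\<lambda>\<epsilon>. \<epsilon> powr e) \<longlongrightarrow> 0) (at_right (0::real))"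
  by (rule tendsto_zero_powrI[where b = e])
    (auto intro: tendsto_ident_at eventually_at_right_less[THEN eventually_mono] less_imp_le)

text \<open>The mass off \<open>zstar\<close> is at most a finite sum of positive powers of
  \<open>\<epsilon>\<close> with fixed coefficients, which tends to 0.\<close>

lemma zstar_mass:
  assumes "t < 1"
  shows "\<exists>\<epsilon>0>0. \<forall>\<epsilon>. 0 < \<epsilon> \<and> \<epsilon> < \<epsilon>0 \<longrightarrow> (\<forall>\<pi>. stationary N M mu c \<epsilon> \<pi> \<longrightarrow> t < \<pi> zstar)"
proof -
  obtain K where K: "0 < K"
    "\<And>\<epsilon> \<pi> x. 0 < \<epsilon> \<Longrightarrow> \<epsilon> < 1 \<Longrightarrow> \<epsilon> powr c \<le> 1 / 2 \<Longrightarrow> stationary N M mu c \<epsilon> \<pi> \<Longrightarrow>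
       x \<in> states N M \<Longrightarrow> \<pi> x \<le> K * \<epsilon> powr excess x * \<pi> zstar"
    using stationary_le_zstar by metis
  let ?F = "\<lambda>\<epsilon>. \<Sum>x\<in>states N M - {zstar}. K * \<epsilon> powr excess x"
  have "(?F \<longlongrightarrow> (\<Sum>x\<in>states N M - {zstar}. K * 0)) (at_right 0)"
    by (intro tendsto_sum tendsto_mult_left tendsto_powr_at_right_0 excess_pos) auto
  then have F: "(?F \<longlongrightarrow> 0) (at_right 0)" by simp
  have "eventually (\<lambda>\<epsilon>. ?F \<epsilon> < 1 - t) (at_right 0)"
    using F assms by (intro order_tendstoD(2)) auto
  moreover have "eventually (\<lambda>\<epsilon>. \<epsilon> powr c < 1 / 2) (at_right (0::real))"
    using tendsto_powr_at_right_0[OF c_pos] by (rule order_tendstoD(2)) simp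
  moreover have "eventually (\<lambda>\<epsilon>. \<epsilon> < 1) (at_right (0::real))"
    by (rule order_tendstoD(2)[OF tendsto_ident_at]) simp
  ultimately have "eventually (\<lambda>\<epsilon>. ?F \<epsilon> < 1 - t \<and> \<epsilon> powr c < 1 / 2 \<and> \<epsilon> < 1) (at_right 0)"
    by eventually_elim simp
  then obtain \<epsilon>0 where e0: "0 < \<epsilon>0"
    "\<And>\<epsilon>. 0 < \<epsilon> \<Longrightarrow> \<epsilon> < \<epsilon>0 \<Longrightarrow> ?F \<epsilon> < 1 - t \<and> \<epsilon> powr c < 1 / 2 \<and> \<epsilon> < 1"
    by (auto simp: eventually_at_right_field)
  have "t < \<pi> zstar" if e: "0 < \<epsilon>" "\<epsilon> < \<epsilon>0" and st: "stationary N M mu c \<epsilon> \<pi>" for \<epsilon> \<pi>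
  proof -
    have nn: "\<And>x. x \<in> states N M \<Longrightarrow> 0 \<le> \<pi> x" and one: "(\<Sum>x\<in>states N M. \<pi> x) = 1"
      using st by (auto simp: stationary_def)
    have split: "1 = \<pi> zstar + (\<Sum>x\<in>states N M - {zstar}. \<pi> x)"
      using one sum.remove[OF finite_states zstar_in_states, of \<pi>] by simp
    have le1: "\<pi> zstar \<le> 1"
      using split sum_nonneg[of "states N M - {zstar}" \<pi>] nn by simp
    have "(\<Sum>x\<in>states N M - {zstar}. \<pi> x) \<le> (\<Sum>x\<in>states N M - {zstar}. K * \<epsilon> powr excess x * \<pi> zstar)"
      using e0(2)[OF e] e st by (intro sum_mono K(2)) auto
    also have "\<dots> = ?F \<epsilon> * \<pi> zstar" by (simp add: sum_distrib_right)
    also have "\<dots> \<le> ?F \<epsilon>"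
      using le1 nn[OF zstar_in_states] K(1) by (intro mult_left_le sum_nonneg) auto
    finally show ?thesis using split e0(2)[OF e] by linarith
  qed
  then show ?thesis using e0(1) by blast
qed

end

theorem theorem2:
  fixes N M :: nat and mu :: "nat \<Rightarrow> nat \<Rightarrow> real" and c :: real
    and astar :: "nat \<Rightarrow> nat"
  assumes "2 \<le> N" and "N \<le> M"
    and "\<And>n i. n \<in> {1..N} \<Longrightarrow> i \<in> {1..M} \<Longrightarrow> mu n i > 0"
    and "astar \<in> profiles N M"
    and "\<And>a. a \<in> profiles N M \<Longrightarrow> a \<noteq> astar \<Longrightarrow>
           (\<Sum>n\<in>{1..N}. util N mu n a) < (\<Sum>n\<in>{1..N}. util N mu n astar)"
    and "c > 0"
    and "c > (\<Sum>n\<in>{1..N}. umax N M mu n) - (\<Sum>n\<in>{1..N}. util N mu n astar)"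
  shows "\<forall>\<eta>::real. 0 < \<eta> \<and> \<eta> < 1/2 \<longrightarrow>
           (\<exists>\<epsilon>0>0. \<forall>\<epsilon>. 0 < \<epsilon> \<and> \<epsilon> < \<epsilon>0 \<longrightarrow>
              (\<forall>\<pi>. stationary N M mu c \<epsilon> \<pi> \<longrightarrow>
                 \<pi> (restrict (\<lambda>n. (astar n, True)) {1..N}) > 1 / (2 * (1 - \<eta>))))"
proof (intro allI impI)
  fix \<eta> :: real assume \<eta>: "0 < \<eta> \<and> \<eta> < 1/2"
  interpret got_opt N M mu c astar using assms by unfold_locales auto
  \<comment> \<open>The concentration result covers every threshold below 1, and
    \<open>\<eta> < 1/2\<close> puts this one there.\<close>
  have "1 / (2 * (1 - \<eta>)) < 1" using \<eta> by simp
  from zstar_mass[OF this]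
  show "\<exists>\<epsilon>0>0. \<forall>\<epsilon>. 0 < \<epsilon> \<and> \<epsilon> < \<epsilon>0 \<longrightarrow> (\<forall>\<pi>. stationary N M mu c \<epsilon> \<pi> \<longrightarrow>
     \<pi> (restrict (\<lambda>n. (astar n, True)) {1..N}) > 1 / (2 * (1 - \<eta>)))"
    unfolding zstar_def .
qed

end
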